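(* Let $G$ be a finitely generated group, $G_0$ a normal finite index subgroup of $G$, and suppose that $T$ is a canonical $G_0$-tree. Then: (i) $G$ acts on $T$ by isometries, and this action restricts to the given canonical $G_0$-action; (ii) with this action, $T$ is nearly canonical as a $G$-tree.
   Context: Trees are (simplicial metric) trees, and actions are isometric, given by a homomorphism $G\to\operatorname{Isom}(T)$. For $g\in G$, $\operatorname{Ad}(g)$ denotes the inner automorphism of $G$ induced by conjugation by $g$, namely $x\mapsto g^{-1}xg$ (automorphisms and actions are written on the right, so that $g\mapsto\operatorname{Ad}(g)$ is a homomorphism $G\to\operatorname{Aut}(G)$). An action $G\to\operatorname{Isom}(T)$ is canonical if there is a homomorphism $\rho:\operatorname{Aut}(G)\to\operatorname{Isom}(T)$ such that for every $g\in G$ the isometry $\rho(\operatorname{Ad}(g))$ equals the isometry by which $g$ acts on $T$. An action $G\to\operatorname{Isom}(T)$ is nearly canonical if there are a finite index subgroup $A$ of $\operatorname{Aut}(G)$ with $\operatorname{Inn}(G)\le A$ and a homomorphism $\rho:A\to\operatorname{Isom}(T)$ such that for every $g\in G$ the isometry $\rho(\operatorname{Ad}(g))$ equals the isometry by which $g$ acts on $T$. *)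

theory Defs
  imports "HOL-Algebra.Algebra" "HOL-Analysis.Abstract_Metric_Spaces"
begin

section \<open>Simplicial metric trees\<close>

text \<open>
  Graphs are undirected, without loops or multiple edges: an edge is the set of its two endpoints.
  A simplicial tree need not be finite or locally finite.
\<close>

definition simplicial_tree :: "'a set \<Rightarrow> 'a set set \<Rightarrow> bool" where
  "simplicial_tree V E \<longleftrightarrow>
     V \<noteq> {} \<and>
     (\<forall>e\<in>E. \<exists>u\<in>V. \<exists>v\<in>V. u \<noteq> v \<and> e = {u, v}) \<and>
     (\<forall>u\<in>V. \<forall>v\<in>V. (u, v) \<in> {(x, y). {x, y} \<in> E}\<^sup>*) \<and>
     (\<nexists>xs. 3 \<le> length xs \<and> distinct xs \<and> successively (\<lambda>x y. {x, y} \<in> E) xs \<and>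
           {last xs, hd xs} \<in> E)"

definition geodesic_segment :: "'a metric \<Rightarrow> 'a set \<Rightarrow> 'a \<Rightarrow> 'a \<Rightarrow> bool" where
  "geodesic_segment T S x y \<longleftrightarrow>
     S \<subseteq> mspace T \<and>
     (\<exists>\<gamma>. \<gamma> 0 = x \<and> \<gamma> (mdist T x y) = y \<and> \<gamma> ` {0..mdist T x y} = S \<and>
        (\<forall>s\<in>{0..mdist T x y}. \<forall>t\<in>{0..mdist T x y}. mdist T (\<gamma> s) (\<gamma> t) = \<bar>s - t\<bar>))"

text \<open>
  The metric space \<open>T\<close> is a geometric realization of a simplicial tree with vertex set \<open>V\<close> and
  edge set \<open>E\<close>: the edge \<open>e\<close> is realized by the closed segment \<open>\<sigma> e\<close>, of arbitrary positive
  length, and the metric is the path metric, the infimum being taken over chains of points in which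
  consecutive points lie on a common closed edge.
\<close>

definition tree_realization ::
  "'a metric \<Rightarrow> 'a set \<Rightarrow> 'a set set \<Rightarrow> ('a set \<Rightarrow> 'a set) \<Rightarrow> bool" where
  "tree_realization T V E \<sigma> \<longleftrightarrow>
     simplicial_tree V E \<and>
     (\<forall>u v. {u, v} \<in> E \<longrightarrow> geodesic_segment T (\<sigma> {u, v}) u v) \<and>
     mspace T = V \<union> (\<Union>e\<in>E. \<sigma> e) \<and>
     (\<forall>e\<in>E. \<sigma> e \<inter> V = e) \<and>
     (\<forall>e\<in>E. \<forall>f\<in>E. e \<noteq> f \<longrightarrow> \<sigma> e \<inter> \<sigma> f = e \<inter> f) \<and>
     (\<forall>x\<in>mspace T. \<forall>y\<in>mspace T.
        mdist T x y =
          Inf {sum_list (map2 (mdist T) xs (tl xs)) | xs.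
                 xs \<noteq> [] \<and> hd xs = x \<and> last xs = y \<and>
                 successively (\<lambda>a b. \<exists>e\<in>E. a \<in> \<sigma> e \<and> b \<in> \<sigma> e) xs})"

definition simplicial_metric_tree :: "'a metric \<Rightarrow> bool" where
  "simplicial_metric_tree T \<longleftrightarrow> (\<exists>V E \<sigma>. tree_realization T V E \<sigma>)"


section \<open>Groups of automorphisms and of isometries\<close>

text \<open>
  Maps are written on the right, so a product \<open>f g\<close> of maps means first \<open>f\<close>, then \<open>g\<close>. The library's
  groups of bijections use the opposite convention.
\<close>

definition opposite_monoid :: "('a, 'b) monoid_scheme \<Rightarrow> ('a, 'b) monoid_scheme" where
  "opposite_monoid G = G\<lparr>mult := \<lambda>x y. y \<otimes>\<^bsub>G\<^esub> x\<rparr>"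

definition Aut :: "('a, 'b) monoid_scheme \<Rightarrow> ('a \<Rightarrow> 'a) monoid" where
  "Aut G = opposite_monoid (AutoGroup G)"

definition isometries :: "'a metric \<Rightarrow> ('a \<Rightarrow> 'a) set" where
  "isometries T =
     {f \<in> Bij (mspace T). \<forall>x\<in>mspace T. \<forall>y\<in>mspace T. mdist T (f x) (f y) = mdist T x y}"

definition Isom :: "'a metric \<Rightarrow> ('a \<Rightarrow> 'a) monoid" where
  "Isom T = opposite_monoid (BijGroup (mspace T)\<lparr>carrier := isometries T\<rparr>)"

definition Ad :: "('a, 'b) monoid_scheme \<Rightarrow> 'a \<Rightarrow> 'a \<Rightarrow> 'a" where
  "Ad G g = (\<lambda>x\<in>carrier G. inv\<^bsub>G\<^esub> g \<otimes>\<^bsub>G\<^esub> x \<otimes>\<^bsub>G\<^esub> g)"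

definition Inn :: "('a, 'b) monoid_scheme \<Rightarrow> ('a \<Rightarrow> 'a) set" where
  "Inn G = Ad G ` carrier G"

definition finitely_generated :: "('a, 'b) monoid_scheme \<Rightarrow> bool" where
  "finitely_generated G \<longleftrightarrow> (\<exists>S. finite S \<and> S \<subseteq> carrier G \<and> generate G S = carrier G)"

definition finite_index_subgroup :: "'a set \<Rightarrow> ('a, 'b) monoid_scheme \<Rightarrow> bool" where
  "finite_index_subgroup H G \<longleftrightarrow> subgroup H G \<and> finite (rcosets\<^bsub>G\<^esub> H)"


section \<open>Canonical and nearly canonical actions\<close>

definition isometric_action ::
  "('a, 'b) monoid_scheme \<Rightarrow> 'c metric \<Rightarrow> ('a \<Rightarrow> 'c \<Rightarrow> 'c) \<Rightarrow> bool" where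
  "isometric_action G T \<phi> \<longleftrightarrow> \<phi> \<in> hom G (Isom T)"

definition canonical_action ::
  "('a, 'b) monoid_scheme \<Rightarrow> 'c metric \<Rightarrow> ('a \<Rightarrow> 'c \<Rightarrow> 'c) \<Rightarrow> bool" where
  "canonical_action G T \<phi> \<longleftrightarrow>
     isometric_action G T \<phi> \<and>
     (\<exists>\<rho> \<in> hom (Aut G) (Isom T). \<forall>g\<in>carrier G. \<rho> (Ad G g) = \<phi> g)"

definition nearly_canonical_action ::
  "('a, 'b) monoid_scheme \<Rightarrow> 'c metric \<Rightarrow> ('a \<Rightarrow> 'c \<Rightarrow> 'c) \<Rightarrow> bool" where
  "nearly_canonical_action G T \<phi> \<longleftrightarrow>
     isometric_action G T \<phi> \<and>
     (\<exists>A. finite_index_subgroup A (Aut G) \<and> Inn G \<subseteq> A \<and>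
        (\<exists>\<rho> \<in> hom (Aut G\<lparr>carrier := A\<rparr>) (Isom T). \<forall>g\<in>carrier G. \<rho> (Ad G g) = \<phi> g))"

end

(* Conjugation by g in G is an automorphism of the normal subgroup G0, so g acts on T by
   rho (Ad g restricted to G0), where rho comes from the canonical structure of T.  The group A of
   automorphisms of G preserving G0 also acts through restriction to G0 followed by rho, and it
   contains Inn G.  A coset of A in Aut G is determined by the image of G0, which is the kernel of
   the composite of an automorphism with the projection G -> G/G0.  A finitely generated
   group has only finitely many homomorphisms to a finite group, so A has finite index. *)

theory Submission
  imports Defs
begin

section \<open>Homomorphisms from a finitely generated group to a finite group\<close>

lemma (in group) hom_eq_on_generate:
  assumes "group H" "h \<in> hom G H" "k \<in> hom G H" "S \<subseteq> carrier G"
    and eq: "\<And>s. s \<in> S \<Longrightarrow> h s = k s"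
    and "x \<in> generate G S"
  shows "h x = k x"
  using \<open>x \<in> generate G S\<close>
proof (induction rule: generate.induct)
  case one
  then show ?case
    using assms by (simp add: hom_one)
next
  case (incl s)
  then show ?case by (rule eq)
next
  case (inv s)
  interpret h: group_hom G H h
    using assms by (simp add: group_hom_def group_hom_axioms_def)
  interpret k: group_hom G H k
    using assms by (simp add: group_hom_def group_hom_axioms_def)
  have "s \<in> carrier G"
    using inv \<open>S \<subseteq> carrier G\<close> by blast
  then show ?case
    using eq[OF inv] by simp
next
  case (eng a b)
  then have "a \<in> carrier G" "b \<in> carrier G"
    using generate_in_carrier[OF \<open>S \<subseteq> carrier G\<close>] by auto
  then show ?case
    using eng assms by (simp add: hom_mult)
qed

text \<open>A homomorphism is determined by its values on a finite generating set \<open>S\<close>,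
  and there are only finitely many functions from \<open>S\<close> to the finite group. The
  restriction to \<open>carrier G\<close> is essential to the count: \<open>hom\<close> leaves the
  values outside the carrier arbitrary.\<close>

lemma (in group) finite_restricted_homs:
  assumes "finitely_generated G" "group H" "finite (carrier H)"
  shows "finite ((\<lambda>h. restrict h (carrier G)) ` hom G H)" (is "finite (?r ` _)")
proof -
  obtain S where S: "finite S" "S \<subseteq> carrier G" "generate G S = carrier G"
    using assms by (auto simp: finitely_generated_def)
  have "(\<lambda>k. restrict k S) ` ?r ` hom G H \<subseteq> S \<rightarrow>\<^sub>E carrier H"
    using S(2) by (auto simp: hom_def Pi_iff PiE_iff)
  then have "finite ((\<lambda>k. restrict k S) ` ?r ` hom G H)"
    using S(1) \<open>finite (carrier H)\<close> by (meson finite_PiE finite_subset)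
  moreover have "inj_on (\<lambda>k. restrict k S) (?r ` hom G H)"
  proof (rule inj_onI, elim imageE, simp only:)
    fix h k assume h: "h \<in> hom G H" and k: "k \<in> hom G H"
      and eq: "restrict (?r h) S = restrict (?r k) S"
    have "h s = k s" if "s \<in> S" for s
      using fun_cong[OF eq, of s] that S(2) by auto
    then have "h x = k x" if "x \<in> carrier G" for x
      using hom_eq_on_generate[OF \<open>group H\<close> h k S(2)] S(3) that by simp
    then show "?r h = ?r k"
      by (auto intro: restrict_ext)
  qed
  ultimately show ?thesis
    by (rule finite_imageD)
qed

text \<open>The preimage of \<open>H\<close> under \<alpha> is the kernel of \<alpha> followed by
  the projection to the finite group \<open>G Mod H\<close>, so it depends only on one of finitely
  many restricted homomorphisms.\<close>

lemma (in normal) finite_hom_vimages: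
  assumes "finitely_generated G" "finite (rcosets H)"
  shows "finite {{x \<in> carrier G. \<alpha> x \<in> H} | \<alpha>. \<alpha> \<in> hom G G}"
proof -
  let ?homs = "(\<lambda>h. restrict h (carrier G)) ` hom G (G Mod H)"
  have "{x \<in> carrier G. \<alpha> x \<in> H} \<in> (\<lambda>k. {x \<in> carrier G. k x = H}) ` ?homs"
    if \<alpha>: "\<alpha> \<in> hom G G" for \<alpha>
  proof -
    have "(\<lambda>a. H #> a) \<circ> \<alpha> \<in> hom G (G Mod H)"
      using Group.hom_compose[OF \<alpha> r_coset_hom_Mod] .
    \<comment> \<open>The coset \<open>H\<close> is the identity of \<open>G Mod H\<close>, so this
      is membership in the kernel of the composite.\<close>
    moreover have "\<alpha> x \<in> H \<longleftrightarrow> H #> \<alpha> x = H" if "x \<in> carrier G" for x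
      using coset_join1 coset_join2 hom_in_carrier[OF \<alpha> that] subgroup_axioms subset by metis
    then have "{x \<in> carrier G. \<alpha> x \<in> H}
        = {x \<in> carrier G. restrict ((\<lambda>a. H #> a) \<circ> \<alpha>) (carrier G) x = H}"
      by auto
    ultimately show ?thesis by blast
  qed
  moreover have "finite ?homs"
    using finite_restricted_homs[OF assms(1) factorgroup_is_group] assms(2)
    by (simp add: FactGroup_def)
  ultimately show ?thesis
    by (elim finite_subset[OF _ finite_imageI, rotated]) blast
qed

section \<open>The automorphism group with maps written on the right, and conjugations\<close>

lemma carrier_Aut [simp]: "carrier (Aut G) = auto G"
  by (simp add: Aut_def opposite_monoid_def AutoGroup_def)

lemma one_Aut [simp]: "\<one>\<^bsub>Aut G\<^esub> = (\<lambda>x\<in>carrier G. x)"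
  by (simp add: Aut_def opposite_monoid_def AutoGroup_def BijGroup_def)

lemma mult_Aut:
  assumes "\<alpha> \<in> auto G" "\<beta> \<in> auto G"
  shows "\<alpha> \<otimes>\<^bsub>Aut G\<^esub> \<beta> = compose (carrier G) \<beta> \<alpha>"
  using assms by (simp add: Aut_def opposite_monoid_def AutoGroup_def BijGroup_def auto_def)

lemma group_opposite_monoid:
  assumes "group G"
  shows "group (opposite_monoid G)"
proof -
  interpret group G by fact
  show ?thesis
    by (rule groupI) (auto simp: opposite_monoid_def m_assoc intro: r_inv_ex)
qed

lemma (in group) group_Aut: "group (Aut G)"
  unfolding Aut_def by (rule group_opposite_monoid[OF AutoGroup])

lemma auto_bij_betw: "\<alpha> \<in> auto G \<Longrightarrow> bij_betw \<alpha> (carrier G) (carrier G)"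
  by (simp add: auto_def Bij_def)

lemma (in group) inv_Aut:
  assumes "\<alpha> \<in> auto G"
  shows "inv\<^bsub>Aut G\<^esub> \<alpha> = (\<lambda>x\<in>carrier G. inv_into (carrier G) \<alpha> x)"
proof (rule group.inv_equality[OF group_Aut])
  \<comment> \<open>Members of \<open>auto G\<close> are extensional, hence the restriction of
    \<open>inv_into\<close>.\<close>
  let ?\<beta> = "\<lambda>x\<in>carrier G. inv_into (carrier G) \<alpha> x"
  have \<beta>: "?\<beta> \<in> auto G"
    using assms by (simp add: auto_def restrict_inv_into_Bij restrict_inv_into_hom)
  show "?\<beta> \<otimes>\<^bsub>Aut G\<^esub> \<alpha> = \<one>\<^bsub>Aut G\<^esub>"
    using bij_betw_inv_into_right[OF auto_bij_betw[OF assms]]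
    by (auto simp: mult_Aut[OF \<beta> assms] compose_def)
  show "\<alpha> \<in> carrier (Aut G)" "?\<beta> \<in> carrier (Aut G)"
    using assms \<beta> by auto
qed

lemma (in group) Ad_in_auto:
  assumes g: "g \<in> carrier G"
  shows "Ad G g \<in> auto G"
proof -
  \<comment> \<open>Once \<open>m_assoc\<close> has moved all brackets to the right, these are the
    cancellations still needed.\<close>
  have cancel: "g \<otimes> (inv g \<otimes> x) = x" "inv g \<otimes> (g \<otimes> x) = x" if "x \<in> carrier G" for x
    using g that by (simp_all add: m_assoc[symmetric])
  have "Ad G g \<in> hom G G"
    using g by (auto simp: hom_def Ad_def m_assoc cancel)
  moreover have "bij_betw (Ad G g) (carrier G) (carrier G)"
    by (rule bij_betw_byWitness[where f' = "\<lambda>x. g \<otimes> x \<otimes> inv g"])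
      (use g in \<open>auto simp: Ad_def m_assoc cancel\<close>)
  ultimately show ?thesis
    by (simp add: auto_def Bij_def Ad_def)
qed

text \<open>Conjugating as \<open>inv g \<otimes> x \<otimes> g\<close>, first by \<open>g\<close>
  and then by \<open>h\<close>, is conjugating by \<open>g \<otimes> h\<close>; the opposite product
  in \<open>Aut G\<close> composes in this same order.\<close>

lemma (in group) Ad_hom: "Ad G \<in> hom G (Aut G)"
proof (rule homI)
  fix g h assume "g \<in> carrier G" "h \<in> carrier G"
  then show "Ad G (g \<otimes> h) = Ad G g \<otimes>\<^bsub>Aut G\<^esub> Ad G h"
    by (simp add: mult_Aut Ad_in_auto)
      (auto simp: Ad_def compose_def inv_mult_group m_assoc)
qed (simp add: Ad_in_auto)

section \<open>Automorphisms preserving a subset, and the index of their group\<close>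

definition setwise_stabilizer :: "('a, 'b) monoid_scheme \<Rightarrow> 'a set \<Rightarrow> ('a \<Rightarrow> 'a) set" where
  "setwise_stabilizer G H = {\<alpha> \<in> auto G. \<alpha> ` H = H}"

lemma image_mult_Aut:
  assumes "\<alpha> \<in> auto G" "\<beta> \<in> auto G" "H \<subseteq> carrier G"
  shows "(\<alpha> \<otimes>\<^bsub>Aut G\<^esub> \<beta>) ` H = \<beta> ` \<alpha> ` H"
  using assms by (auto simp: mult_Aut compose_def image_image intro!: image_cong)

lemma (in group) image_inv_Aut:
  assumes \<alpha>: "\<alpha> \<in> auto G" and "H \<subseteq> carrier G"
  shows "(inv\<^bsub>Aut G\<^esub> \<alpha>) ` \<alpha> ` H = H"
proof -
  interpret A: group "Aut G" by (rule group_Aut)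
  have "(inv\<^bsub>Aut G\<^esub> \<alpha>) ` \<alpha> ` H = \<one>\<^bsub>Aut G\<^esub> ` H"
    using image_mult_Aut[OF \<alpha> _ \<open>H \<subseteq> carrier G\<close>, of "inv\<^bsub>Aut G\<^esub> \<alpha>"] A.inv_closed[of \<alpha>] A.r_inv[of \<alpha>] \<alpha>
    by (simp del: one_Aut)
  also have "\<dots> = H"
    using \<open>H \<subseteq> carrier G\<close> by (force simp: image_iff)
  finally show ?thesis .
qed

lemma (in group) subgroup_setwise_stabilizer:
  assumes H: "H \<subseteq> carrier G"
  shows "subgroup (setwise_stabilizer G H) (Aut G)"
proof (rule group.subgroupI[OF group_Aut])
  show "setwise_stabilizer G H \<subseteq> carrier (Aut G)"
    by (auto simp: setwise_stabilizer_def)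
  have "\<one>\<^bsub>Aut G\<^esub> \<in> setwise_stabilizer G H"
    using H by (auto simp: setwise_stabilizer_def id_in_auto subset_iff)
  then show "setwise_stabilizer G H \<noteq> {}" by blast
next
  fix \<alpha> assume "\<alpha> \<in> setwise_stabilizer G H"
  then show "inv\<^bsub>Aut G\<^esub> \<alpha> \<in> setwise_stabilizer G H"
    using image_inv_Aut[OF _ H, of \<alpha>] group.inv_closed[OF group_Aut, of \<alpha>]
    by (auto simp: setwise_stabilizer_def)
next
  fix \<alpha> \<beta> assume "\<alpha> \<in> setwise_stabilizer G H" "\<beta> \<in> setwise_stabilizer G H"
  then show "\<alpha> \<otimes>\<^bsub>Aut G\<^esub> \<beta> \<in> setwise_stabilizer G H"
    using image_mult_Aut[OF _ _ H, of \<alpha> \<beta>] monoid.m_closed[OF group.is_monoid[OF group_Aut], of \<alpha> \<beta>]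
    by (auto simp: setwise_stabilizer_def)
qed

text \<open>If \<alpha> and \<beta> send \<open>H\<close> to the same set, then \<beta> followed by
  the inverse of \<alpha> preserves \<open>H\<close>. Counting cosets thus becomes counting images
  of \<open>H\<close>.\<close>

lemma (in group) r_coset_setwise_stabilizer:
  assumes H: "H \<subseteq> carrier G" and \<alpha>: "\<alpha> \<in> auto G"
  shows "setwise_stabilizer G H #>\<^bsub>Aut G\<^esub> \<alpha> = {\<beta> \<in> auto G. \<beta> ` H = \<alpha> ` H}"
proof -
  interpret A: group "Aut G" by (rule group_Aut)
  have "\<beta> \<in> setwise_stabilizer G H #>\<^bsub>Aut G\<^esub> \<alpha>" if \<beta>: "\<beta> \<in> auto G" "\<beta> ` H = \<alpha> ` H" for \<beta>
  proof -
    let ?\<gamma> = "\<beta> \<otimes>\<^bsub>Aut G\<^esub> inv\<^bsub>Aut G\<^esub> \<alpha>"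
    have inv: "inv\<^bsub>Aut G\<^esub> \<alpha> \<in> auto G"
      using A.inv_closed[of \<alpha>] \<alpha> by simp
    then have "?\<gamma> \<in> auto G"
      using A.m_closed[of \<beta>] \<beta> by simp
    moreover have "?\<gamma> ` H = H"
      using image_mult_Aut[OF \<beta>(1) inv H] \<beta>(2) image_inv_Aut[OF \<alpha> H] by simp
    moreover have "\<beta> = ?\<gamma> \<otimes>\<^bsub>Aut G\<^esub> \<alpha>"
      using A.m_assoc[of \<beta> "inv\<^bsub>Aut G\<^esub> \<alpha>" \<alpha>] A.l_inv[of \<alpha>] A.r_one[of \<beta>] \<alpha> \<beta> inv
      by (simp del: one_Aut)
    ultimately show ?thesis
      by (auto simp: r_coset_def setwise_stabilizer_def)
  qed
  moreover have "\<gamma> \<otimes>\<^bsub>Aut G\<^esub> \<alpha> \<in> auto G \<and> (\<gamma> \<otimes>\<^bsub>Aut G\<^esub> \<alpha>) ` H = \<alpha> ` H"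
    if "\<gamma> \<in> setwise_stabilizer G H" for \<gamma>
    using that image_mult_Aut[OF _ \<alpha> H, of \<gamma>] A.m_closed[of \<gamma> \<alpha>] \<alpha>
    by (simp add: setwise_stabilizer_def)
  ultimately show ?thesis
    unfolding r_coset_def by blast
qed

text \<open>The image of \<open>H\<close> under \<alpha> is its preimage under the inverse
  automorphism, so \<open>finite_hom_vimages\<close> applies.\<close>

lemma (in normal) finite_auto_images:
  assumes "finitely_generated G" "finite (rcosets H)"
  shows "finite ((\<lambda>\<alpha>. \<alpha> ` H) ` auto G)"
proof (rule finite_subset[OF _ finite_hom_vimages[OF assms]], clarify)
  fix \<alpha> assume \<alpha>: "\<alpha> \<in> auto G"
  let ?\<beta> = "inv\<^bsub>Aut G\<^esub> \<alpha>"
  have "?\<beta> \<in> auto G"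
    using group.inv_closed[OF group_Aut, of \<alpha>] \<alpha> by simp
  then have "?\<beta> \<in> hom G G"
    by (simp add: auto_def)
  moreover have "\<alpha> ` H = {x \<in> carrier G. ?\<beta> x \<in> H}"
  proof
    show "\<alpha> ` H \<subseteq> {x \<in> carrier G. ?\<beta> x \<in> H}"
      using auto_bij_betw[OF \<alpha>] subset by (auto simp: inv_Aut[OF \<alpha>] bij_betw_def)
    show "{x \<in> carrier G. ?\<beta> x \<in> H} \<subseteq> \<alpha> ` H"
    proof clarify
      fix x assume "x \<in> carrier G" "?\<beta> x \<in> H"
      then show "x \<in> \<alpha> ` H"
        using bij_betw_inv_into_right[OF auto_bij_betw[OF \<alpha>]]
        by (metis inv_Aut[OF \<alpha>] image_eqI restrict_apply')
    qed
  qed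
  ultimately show "\<exists>\<beta>. \<alpha> ` H = {x \<in> carrier G. \<beta> x \<in> H} \<and> \<beta> \<in> hom G G"
    by blast
qed

lemma (in normal) finite_index_setwise_stabilizer:
  assumes "finitely_generated G" "finite (rcosets H)"
  shows "finite_index_subgroup (setwise_stabilizer G H) (Aut G)"
proof -
  \<comment> \<open>Each coset is a fibre of the map sending an automorphism to its image of
    \<open>H\<close>.\<close>
  have "rcosets\<^bsub>Aut G\<^esub> (setwise_stabilizer G H)
      \<subseteq> (\<lambda>K. {\<beta> \<in> auto G. \<beta> ` H = K}) ` (\<lambda>\<alpha>. \<alpha> ` H) ` auto G"
    using r_coset_setwise_stabilizer[OF subset] by (auto simp: RCOSETS_def)
  then show ?thesis
    using finite_auto_images[OF assms] subgroup_setwise_stabilizer[OF subset]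
    unfolding finite_index_subgroup_def by (meson finite_imageI finite_subset)
qed

section \<open>Restriction of automorphisms to the subgroup, and the extended action\<close>

lemma (in subgroup) restrict_setwise_stabilizer_hom:
  "(\<lambda>\<alpha>. restrict \<alpha> H) \<in> hom (Aut G\<lparr>carrier := setwise_stabilizer G H\<rparr>) (Aut (G\<lparr>carrier := H\<rparr>))"
proof -
  have mem: "restrict \<alpha> H \<in> auto (G\<lparr>carrier := H\<rparr>)" if "\<alpha> \<in> setwise_stabilizer G H" for \<alpha>
  proof -
    have \<alpha>: "\<alpha> \<in> auto G" "\<alpha> ` H = H"
      using that by (auto simp: setwise_stabilizer_def)
    then have "bij_betw \<alpha> H H"
      using auto_bij_betw[OF \<alpha>(1)] subset by (auto simp: bij_betw_def intro: inj_on_subset)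
    moreover have "\<alpha> (x \<otimes> y) = \<alpha> x \<otimes> \<alpha> y" if "x \<in> H" "y \<in> H" for x y
      using \<alpha>(1) that by (auto simp: auto_def hom_def)
    ultimately show ?thesis
      using \<alpha>(2) by (auto simp: auto_def hom_def Bij_def bij_betw_restrict_eq)
  qed
  show ?thesis
  proof (rule homI; simp add: mem)
    fix \<alpha> \<beta> assume ab: "\<alpha> \<in> setwise_stabilizer G H" "\<beta> \<in> setwise_stabilizer G H"
    \<comment> \<open>This makes composing on \<open>carrier G\<close> and then restricting agree
      with composing the restrictions on \<open>H\<close>.\<close>
    then have "\<alpha> x \<in> H" if "x \<in> H" for x
      using that by (auto simp: setwise_stabilizer_def)
    then show "restrict (\<alpha> \<otimes>\<^bsub>Aut G\<^esub> \<beta>) H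
        = restrict \<alpha> H \<otimes>\<^bsub>Aut (G\<lparr>carrier := H\<rparr>)\<^esub> restrict \<beta> H"
      using ab mem
      by (auto simp: mult_Aut setwise_stabilizer_def compose_def)
  qed
qed

lemma (in normal) Ad_in_setwise_stabilizer:
  assumes g: "g \<in> carrier G"
  shows "Ad G g \<in> setwise_stabilizer G H"
proof -
  have "Ad G g ` H = H"
  proof
    show "Ad G g ` H \<subseteq> H"
      using inv_op_closed1[OF g] by (auto simp: Ad_def)
    show "H \<subseteq> Ad G g ` H"
    proof
      fix x assume x: "x \<in> H"
      \<comment> \<open>The preimage of \<open>x\<close> is its conjugate by the inverse of
        \<open>g\<close>, which normality keeps in \<open>H\<close>.\<close>
      have "x = inv g \<otimes> (g \<otimes> x \<otimes> inv g) \<otimes> g"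
        using g x by (simp add: m_assoc) (simp add: m_assoc[symmetric])
      then show "x \<in> Ad G g ` H"
        using inv_op_closed2[OF g x] by (auto simp: Ad_def image_iff)
    qed
  qed
  then show ?thesis
    by (simp add: setwise_stabilizer_def Ad_in_auto[OF g])
qed

text \<open>Inverses in the subgroup are those of \<open>G\<close>. This identity is why the action
  of \<open>G\<close> extends the given one.\<close>

lemma (in subgroup) restrict_Ad:
  assumes "group G" "g \<in> H"
  shows "restrict (Ad G g) H = Ad (G\<lparr>carrier := H\<rparr>) g"
proof -
  interpret group G by fact
  show ?thesis
    using m_inv_consistent[OF subgroup_axioms \<open>g \<in> H\<close>] by (auto simp: Ad_def)
qed

theorem proposition3p1p4:
  fixes G :: "('a, 'b) monoid_scheme"
    and G\<^sub>0 :: "'a set"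
    and T :: "'c metric"
    and \<phi>\<^sub>0 :: "'a \<Rightarrow> 'c \<Rightarrow> 'c"
  assumes "group G"
    and "finitely_generated G"
    and "G\<^sub>0 \<lhd> G"
    and "finite_index_subgroup G\<^sub>0 G"
    and "simplicial_metric_tree T"
    and "canonical_action (G\<lparr>carrier := G\<^sub>0\<rparr>) T \<phi>\<^sub>0"
  shows "\<exists>\<phi>. isometric_action G T \<phi> \<and>
             (\<forall>g\<in>G\<^sub>0. \<phi> g = \<phi>\<^sub>0 g) \<and>
             nearly_canonical_action G T \<phi>"
proof -
  interpret normal G\<^sub>0 G by fact
  let ?A = "setwise_stabilizer G G\<^sub>0"
  obtain \<rho> where \<rho>: "\<rho> \<in> hom (Aut (G\<lparr>carrier := G\<^sub>0\<rparr>)) (Isom T)"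
    and \<rho>_Ad: "\<And>g. g \<in> G\<^sub>0 \<Longrightarrow> \<rho> (Ad (G\<lparr>carrier := G\<^sub>0\<rparr>) g) = \<phi>\<^sub>0 g"
    using assms(6) by (auto simp: canonical_action_def)
  \<comment> \<open>This map serves twice: composed with \<open>Ad G\<close> it gives the action of
    \<open>G\<close>, and it is itself the witness for near canonicity, whose compatibility
    condition then holds by definition.\<close>
  define \<rho>A where "\<rho>A = \<rho> \<circ> (\<lambda>\<alpha>. restrict \<alpha> G\<^sub>0)"
  define \<phi> where "\<phi> = \<rho>A \<circ> Ad G"
  have \<rho>A: "\<rho>A \<in> hom (Aut G\<lparr>carrier := ?A\<rparr>) (Isom T)"
    unfolding \<rho>A_def by (rule Group.hom_compose[OF restrict_setwise_stabilizer_hom \<rho>])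
  \<comment> \<open>The target is narrowed from \<open>Aut G\<close> to \<open>?A\<close>, the group
    on which \<open>\<rho>A\<close> is known to be a homomorphism.\<close>
  have "Ad G \<in> hom G (Aut G\<lparr>carrier := ?A\<rparr>)"
    using Ad_hom Ad_in_setwise_stabilizer by (auto simp: hom_def)
  then have act: "isometric_action G T \<phi>"
    unfolding isometric_action_def \<phi>_def by (rule Group.hom_compose[OF _ \<rho>A])
  have "\<phi> g = \<phi>\<^sub>0 g" if "g \<in> G\<^sub>0" for g
    using \<rho>_Ad[OF that] restrict_Ad[OF assms(1) that] by (simp add: \<phi>_def \<rho>A_def)
  moreover have "finite_index_subgroup ?A (Aut G)"
    using finite_index_setwise_stabilizer assms(2,4) by (simp add: finite_index_subgroup_def)
  moreover have "Inn G \<subseteq> ?A"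
    using Ad_in_setwise_stabilizer by (auto simp: Inn_def)
  moreover have "\<forall>g\<in>carrier G. \<rho>A (Ad G g) = \<phi> g"
    by (simp add: \<phi>_def)
  ultimately show ?thesis
    using act \<rho>A unfolding nearly_canonical_action_def by blast
qed

end
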